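(* Let $d\geqslant 3$ and $\mathbb K\in\{\mathbb Z,\mathbb Q,\mathbb R,\mathbb C\}$. Let $\mathcal E$ be a $\mathbb K$--reduced set of binary forms of degree $d$ with coefficients in $\mathbb K$. Assume that any $F\in\mathcal E$ satisfies \[ \Lambda^+ (F) \geqslant \frac{d+3} 2 \cdotp \] Then the set $\mathcal E$ is $\mathbb K$--homography--free, i.e. for any distinct $F,G\in\mathcal E$ there is no $\gamma\in\mathrm{GL}(2,\mathbb K)$ with $F=G\circ\gamma$.
   Context: For a binary form $F(X,Y)=a_0X^d+a_1X^{d-1}Y+\cdots+a_dY^d$ with $a_0a_d\neq 0$, $\Lambda^+(F)=\max\{\ell: a_i=0 \text{ for } 0<i<\ell\}$. A set $\mathcal E$ of binary forms of degree $d$ with coefficients in $\mathbb K$ is $\mathbb K$--reduced if (1) every $F\in\mathcal E$ has $a_0a_d\neq0$; (2) $\mathcal E$ is $\mathbb K$--dilation--free: for $F,G\in\mathcal E$ and $u,v\in\mathbb K^\times$, $F(uX,vY)=G(X,Y)$ implies $F=G$; (3) there is no pair $(F,G)$ of distinct binomial forms $aX^d+bY^d$ in $\mathcal E$ and no $(u,v)\in(\mathbb C^\times)^2$ with $F(vY,uX)=G(X,Y)$. For $F\circ\gamma$, $(F\circ\gamma)(X,Y)=F(u_1X+u_2Y,u_3X+u_4Y)$ when $\gamma$ has rows $(u_1,u_2),(u_3,u_4)$. *)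

theory Defs
  imports "HOL-Analysis.Analysis" "HOL-Computational_Algebra.Polynomial"
begin

text \<open>
  Bivariate polynomials over the complex numbers are elements of \<open>complex poly poly\<close>:
  the inner variable is \<open>X\<close>, the outer variable is \<open>Y\<close>.
  The coefficient domains \<open>\<int>\<close>, \<open>\<rat>\<close>, \<open>\<real>\<close> and the complex numbers are treated uniformly as
  subrings \<open>K\<close> of the complex numbers.
\<close>

definition Const :: "complex \<Rightarrow> complex poly poly" where
  "Const a = [:[:a:]:]"

definition VarX :: "complex poly poly" where
  "VarX = [:[:0, 1:]:]"

definition VarY :: "complex poly poly" where
  "VarY = [:0, 1:]"

definition subst_poly2 ::
    "complex poly poly \<Rightarrow> complex poly poly \<Rightarrow> complex poly poly \<Rightarrow> complex poly poly" where
  "subst_poly2 F P Q = poly (map_poly (\<lambda>c. poly (map_poly Const c) P) F) Q"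

definition binary_forms :: "complex set \<Rightarrow> nat \<Rightarrow> complex poly poly set" where
  "binary_forms K d =
    {F. \<exists>a :: nat \<Rightarrow> complex. (\<forall>i\<le>d. a i \<in> K) \<and>
        F = (\<Sum>i\<le>d. Const (a i) * VarX ^ (d - i) * VarY ^ i)}"

text \<open>The coefficient of \<open>X\<^sup>d\<^sup>-\<^sup>i Y\<^sup>i\<close>, meaningful for \<open>i \<le> d\<close>.\<close>

definition form_coeff :: "nat \<Rightarrow> complex poly poly \<Rightarrow> nat \<Rightarrow> complex" where
  "form_coeff d F i = coeff (coeff F i) (d - i)"

text \<open>
  When \<open>d > 0\<close> and the coefficient of \<open>Y\<^sup>d\<close> is nonzero, the set below contains \<open>0\<close> and is
  bounded by \<open>d\<close>, so the maximum is genuine.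
\<close>

definition Lambda_plus :: "nat \<Rightarrow> complex poly poly \<Rightarrow> nat" where
  "Lambda_plus d F = Max {l. \<forall>i. 0 < i \<and> i < l \<longrightarrow> form_coeff d F i = 0}"

text \<open>The unit group of \<open>K\<close>; in particular it is \<open>{1, -1}\<close> for \<open>K = \<int>\<close>.\<close>

definition unit_group :: "complex set \<Rightarrow> complex set" where
  "unit_group K = {u \<in> K. \<exists>v\<in>K. u * v = 1}"

definition mat2_over :: "complex set \<Rightarrow> (complex^2^2) set" where
  "mat2_over K = {\<gamma>. \<forall>i j. \<gamma> $ i $ j \<in> K}"

definition GL2 :: "complex set \<Rightarrow> (complex^2^2) set" where
  "GL2 K = {\<gamma> \<in> mat2_over K. \<exists>\<delta> \<in> mat2_over K. \<gamma> ** \<delta> = mat 1 \<and> \<delta> ** \<gamma> = mat 1}"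

definition form_comp :: "complex poly poly \<Rightarrow> complex^2^2 \<Rightarrow> complex poly poly" where
  "form_comp F \<gamma> = subst_poly2 F
     (Const (\<gamma> $ 1 $ 1) * VarX + Const (\<gamma> $ 1 $ 2) * VarY)
     (Const (\<gamma> $ 2 $ 1) * VarX + Const (\<gamma> $ 2 $ 2) * VarY)"

definition dilation_free :: "complex set \<Rightarrow> complex poly poly set \<Rightarrow> bool" where
  "dilation_free K E \<longleftrightarrow>
    (\<forall>F\<in>E. \<forall>G\<in>E. \<forall>u\<in>unit_group K. \<forall>v\<in>unit_group K.
       subst_poly2 F (Const u * VarX) (Const v * VarY) = G \<longrightarrow> F = G)"

definition binomial_form :: "nat \<Rightarrow> complex poly poly \<Rightarrow> bool" where
  "binomial_form d F \<longleftrightarrow> (\<exists>a b. F = Const a * VarX ^ d + Const b * VarY ^ d)"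

definition reduced_forms :: "complex set \<Rightarrow> nat \<Rightarrow> complex poly poly set \<Rightarrow> bool" where
  "reduced_forms K d E \<longleftrightarrow>
    (\<forall>F\<in>E. form_coeff d F 0 * form_coeff d F d \<noteq> 0) \<and>
    dilation_free K E \<and>
    \<not> (\<exists>F\<in>E. \<exists>G\<in>E. F \<noteq> G \<and> binomial_form d F \<and> binomial_form d G \<and>
         (\<exists>u\<in>unit_group UNIV. \<exists>v\<in>unit_group UNIV.
            subst_poly2 F (Const v * VarY) (Const u * VarX) = G))"

definition homography_free :: "complex set \<Rightarrow> complex poly poly set \<Rightarrow> bool" where
  "homography_free K E \<longleftrightarrow>
    (\<forall>F\<in>E. \<forall>G\<in>E. F \<noteq> G \<longrightarrow> \<not> (\<exists>\<gamma>\<in>GL2 K. F = form_comp G \<gamma>))"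

end

theory Submission
  imports Defs
begin

text \<open>
  Suppose \<open>F = G \<circ> \<gamma>\<close>, where \<open>\<gamma>\<close> has rows \<open>L\<^sub>1\<close>, \<open>L\<^sub>2\<close>, and put \<open>l = \<lceil>(d + 3) / 2\<rceil>\<close>.  Then
  \<open>a\<^sub>0 X\<^sup>d + Y\<^sup>l A = b\<^sub>0 L\<^sub>1\<^sup>d + L\<^sub>2\<^sup>l B\<close>.  The second order operator \<open>T\<close> that is the product of the
  directional derivatives killing \<open>X\<close> and \<open>L\<^sub>1\<close> annihilates both \<open>d\<close>-th powers, so
  \<open>T F\<close>, a form of degree \<open>d - 2\<close>, is divisible by \<open>Y\<close> and by \<open>L\<^sub>2\<close> to the power \<open>l - 2\<close>.  If \<open>L\<^sub>2\<close> is
  not proportional to \<open>Y\<close>, this forces \<open>T F = 0\<close> because \<open>2 (l - 2) > d - 2\<close>, and comparing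
  coefficients yields that \<open>L\<^sub>1\<close> is proportional to \<open>Y\<close> and \<open>F\<close> is binomial.  The same applies to
  the inverse of \<open>\<gamma>\<close>, so \<open>\<gamma>\<close> is antidiagonal and both forms are binomial.  If \<open>L\<^sub>2\<close> is
  proportional to \<open>Y\<close>, the coefficient of \<open>X\<^sup>d\<^sup>-\<^sup>1 Y\<close> shows that \<open>\<gamma>\<close> is diagonal.
  Both possibilities are excluded for a reduced set.
\<close>

section \<open>Apolarity: a second-order operator that kills two \<open>d\<close>-th powers\<close>

text \<open>The operator \<open>T\<close> in the coordinate \<open>Y\<close>, after setting \<open>X = 1\<close>.\<close>

definition apolar_op :: "nat \<Rightarrow> complex \<Rightarrow> complex \<Rightarrow> complex poly \<Rightarrow> complex poly" where
  "apolar_op d p q f =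
     smult ((of_nat d - 1) * q) (pderiv f) - [:p, q:] * pderiv (pderiv f)"

lemma poly_eq_by_values:
  fixes f g :: "complex poly"
  assumes "\<And>y. poly f y = poly g y"
  shows "f = g"
  using assms by (simp add: fun_eq_iff flip: poly_eq_poly_eq_iff)

lemma apolar_op_add: "apolar_op d p q (f + g) = apolar_op d p q f + apolar_op d p q g"
  by (simp add: apolar_op_def pderiv_add smult_add_right algebra_simps)

lemma coeff_apolar_op:
  "coeff (apolar_op d p q f) j =
     of_nat (Suc j) * ((of_nat d - 1 - of_nat j) * q * coeff f (Suc j)
       - p * of_nat (j + 2) * coeff f (j + 2))"
  by (cases j) (simp_all add: apolar_op_def coeff_pderiv algebra_simps)

text \<open>With \<open>L = p + q y\<close>, both terms equal
  \<open>c d (d - 1) q^2 L^(d - 1)\<close> and cancel.\<close>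

lemma apolar_op_power_eq_0:
  assumes "d \<ge> 2"
  shows "apolar_op d p q (smult c ([:p, q:] ^ d)) = 0"
proof -
  obtain k where d: "d = Suc (Suc k)"
    using assms by (metis Suc_le_D numeral_2_eq_2 Suc_le_mono)
  show ?thesis
    unfolding d apolar_op_def
    by (intro poly_eq_by_values)
       (simp add: pderiv_smult pderiv_power_Suc pderiv_pCons pderiv_mult del: power_Suc mult_pCons_left,
        simp add: algebra_simps)
qed

lemma power_dvd_pderiv:
  fixes r f :: "'a :: idom poly"
  assumes "r ^ Suc n dvd f"
  shows "r ^ n dvd pderiv f"
proof -
  obtain g where "f = r ^ Suc n * g" using assms by blast
  then show ?thesis
    by (simp add: pderiv_mult pderiv_power_Suc del: power_Suc) (simp add: dvd_add dvd_smult)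
qed

text \<open>Each differentiation costs at most one factor \<open>r\<close>.\<close>

lemma power_dvd_apolar_op:
  assumes "r ^ (n + 2) dvd f"
  shows "r ^ n dvd apolar_op d p q f"
proof -
  have 1: "r ^ Suc n dvd pderiv f"
    using assms by (intro power_dvd_pderiv) simp
  then have "r ^ n dvd pderiv f" "r ^ n dvd pderiv (pderiv f)"
    using power_dvd_pderiv power_le_dvd[OF 1, of n] by auto
  then show ?thesis
    unfolding apolar_op_def by (intro dvd_diff dvd_smult dvd_mult)
qed

lemma apolar_op_eq_0:
  fixes u1 u2 u3 u4 :: complex and f B :: "complex poly"
  assumes d: "d \<ge> 3" and l: "2 * l \<ge> d + 3" "l \<le> d" and u3: "u3 \<noteq> 0"
    and f: "f = smult c ([:u1, u2:] ^ d) + [:u3, u4:] ^ l * B"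
    and deg_f: "degree f \<le> d" and deg_B: "degree B \<le> d - l"
    and gap: "\<And>i. 0 < i \<Longrightarrow> i < l \<Longrightarrow> coeff f i = 0"
  shows "apolar_op d u1 u2 f = 0"
proof (rule ccontr)
  let ?T = "apolar_op d u1 u2"
  assume nz: "?T f \<noteq> 0"
  have l3: "l \<ge> 3" using d l by linarith
  have low: "coeff (?T f) j = 0" if "j < l - 2" for j
    using that gap[of "Suc j"] gap[of "j + 2"] by (simp add: coeff_apolar_op)
  \<comment> \<open>At \<open>j = d - 1\<close> the factor \<open>of_nat d - 1 - of_nat j\<close> in
    \<open>coeff_apolar_op\<close> vanishes, so the degree drops by two and not just by one.\<close>
  have high: "coeff (?T f) j = 0" if "j > d - 2" for j
  proof -
    have "j = d - 1 \<or> j \<ge> d" using that by linarith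
    then show ?thesis
      using deg_f d by (auto simp: coeff_apolar_op coeff_eq_0 of_nat_diff)
  qed
  have T: "?T f = ?T ([:u3, u4:] ^ l * B)"
    using d by (simp add: f apolar_op_add apolar_op_power_eq_0)
  show False
  proof (cases "u4 = 0")
    \<comment> \<open>Here the second linear form is a multiple of X, and setting X = 1 makes it
      constant. Divisibility by its power survives as a fall in degree: coefficients from index
      \<open>d - l\<close> on vanish, and \<open>d - l < l - 2\<close>.\<close>
    case True
    have "[:u3, u4:] ^ l * B = smult (u3 ^ l) B"
      by (simp add: True poly_const_pow)
    then have "coeff (?T f) j = 0" if "j \<ge> d - l" for j
      using T deg_B that by (simp add: coeff_apolar_op coeff_eq_0)
    then have "coeff (?T f) j = 0" for j
      using low[of j] l l3 by (cases "j < l - 2") auto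
    then show False using nz by (simp add: poly_eq_iff)
  next
    case False
    define z where "z = - u3 / u4"
    have z: "z \<noteq> 0" using False u3 by (simp add: z_def)
    have L: "[:u3, u4:] = smult u4 [:- z, 1:]"
      using False by (simp add: z_def)
    have "[:u3, u4:] ^ (l - 2) dvd ?T f"
      unfolding T using l3 by (intro power_dvd_apolar_op) (simp del: power_Suc power_add_numeral2 add_2_eq_Suc')
    then have "[:- z, 1:] ^ (l - 2) dvd ?T f"
      unfolding L smult_power using False by (simp add: smult_dvd_iff)
    then have ord: "l - 2 \<le> order z (?T f)"
      using nz by (simp add: order_divides)
    have "monom 1 (l - 2) dvd ?T f"
      using low by (simp add: monom_1_dvd_iff')
    then obtain S where S: "?T f = monom 1 (l - 2) * S" by blast
    have S0: "S \<noteq> 0" using nz S by auto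
    \<comment> \<open>As \<open>z \<noteq> 0\<close>, the two factors share no root, so the whole
      order at \<open>z\<close> falls on \<open>S\<close>. The degree of \<open>?T f\<close> is then
      at least \<open>2 * (l - 2)\<close>, which exceeds \<open>d - 2\<close>.\<close>
    have "order z (monom (1::complex) (l - 2)) = 0"
      using z by (intro order_0I) (simp add: poly_monom)
    then have "order z (?T f) = order z S"
      using nz unfolding S by (simp add: order_mult)
    then have "l - 2 \<le> degree S"
      using ord order_degree[OF S0, of z] by simp
    then have "2 * (l - 2) \<le> degree (?T f)"
      using S0 by (simp add: S degree_mult_eq degree_monom_eq)
    moreover have "degree (?T f) \<le> d - 2"
      using high by (intro degree_le) auto
    ultimately show False using l l3 d by linarith
  qed
qed

section \<open>Linear substitutions between forms with a gap\<close>

text \<open>Vanishing of the operator on \<open>f\<close> is the recurrence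
  \<open>(d - 1 - j) u2 a(j+1) = (j + 2) u1 a(j+2)\<close>. If \<open>u1 \<noteq> 0\<close>, zeros
  propagate from \<open>a 2\<close> up to \<open>a d\<close>, a contradiction. If
  \<open>u1 = 0\<close>, the left factor is nonzero for \<open>j + 1 < d\<close>.\<close>

lemma gap_form_substitution:
  fixes a b :: "nat \<Rightarrow> complex"
  assumes d: "d \<ge> 3" and l: "2 * l \<ge> d + 3" "l \<le> d"
    and gap_a: "\<And>i. 0 < i \<Longrightarrow> i < l \<Longrightarrow> a i = 0"
    and gap_b: "\<And>i. 0 < i \<Longrightarrow> i < l \<Longrightarrow> b i = 0"
    and ad: "a d \<noteq> 0" and u3: "u3 \<noteq> 0"
    and eq: "\<And>x y. (\<Sum>i\<le>d. a i * x ^ (d - i) * y ^ i)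
               = (\<Sum>i\<le>d. b i * (u1 * x + u2 * y) ^ (d - i) * (u3 * x + u4 * y) ^ i)"
  shows "u1 = 0" and "u2 \<noteq> 0 \<Longrightarrow> 0 < i \<Longrightarrow> i < d \<Longrightarrow> a i = 0"
proof -
  define f where "f = (\<Sum>i\<le>d. monom (a i) i)"
  \<comment> \<open>Indices strictly between \<open>0\<close> and \<open>l\<close> drop out, so at
    \<open>x = 1\<close> everything but the \<open>b 0\<close> term is \<open>[:u3, u4:] ^ l\<close>
    times this cofactor.\<close>
  define B where "B = (\<Sum>i=l..d. smult (b i) ([:u1, u2:] ^ (d - i) * [:u3, u4:] ^ (i - l)))"
  have coeff_f: "coeff f i = (if i \<le> d then a i else 0)" for i
    by (simp add: f_def coeff_sum)
  have deg_f: "degree f \<le> d"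
    by (intro degree_le) (simp add: coeff_f)
  have deg_B: "degree B \<le> d - l"
    unfolding B_def
  proof (intro degree_sum_le)
    fix i assume "i \<in> {l..d}"
    have "degree ([:u1, u2:] ^ (d - i) * [:u3, u4:] ^ (i - l))
        \<le> degree ([:u1, u2:] ^ (d - i)) + degree ([:u3, u4:] ^ (i - l))"
      by (rule degree_mult_le)
    also have "\<dots> \<le> degree [:u1, u2:] * (d - i) + degree [:u3, u4:] * (i - l)"
      by (intro add_mono degree_power_le)
    also have "\<dots> \<le> 1 * (d - i) + 1 * (i - l)"
      by (intro add_mono mult_right_mono) auto
    also have "\<dots> = d - l" using \<open>i \<in> {l..d}\<close> by auto
    finally show "degree (smult (b i) ([:u1, u2:] ^ (d - i) * [:u3, u4:] ^ (i - l))) \<le> d - l"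
      using degree_smult_le order_trans by blast
  qed simp
  have f: "f = smult (b 0) ([:u1, u2:] ^ d) + [:u3, u4:] ^ l * B"
  proof (rule poly_eq_by_values)
    fix y
    let ?t = "\<lambda>i. b i * (u1 + u2 * y) ^ (d - i) * (u3 + u4 * y) ^ i"
    have "poly f y = (\<Sum>i\<le>d. ?t i)"
      using eq[of 1 y] by (simp add: f_def poly_sum poly_monom)
    also have "\<dots> = (\<Sum>i\<in>insert 0 {l..d}. ?t i)"
      using gap_b by (intro sum.mono_neutral_right) auto
    also have "\<dots> = ?t 0 + (\<Sum>i=l..d. ?t i)"
      using d l by (subst sum.insert) auto
    also have "(\<Sum>i=l..d. ?t i) = (u3 + u4 * y) ^ l * poly B y"
      unfolding B_def poly_sum sum_distrib_left
      by (intro sum.cong refl) (simp add: algebra_simps flip: power_add)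
    finally show "poly f y = poly (smult (b 0) ([:u1, u2:] ^ d) + [:u3, u4:] ^ l * B) y"
      by (simp add: algebra_simps)
  qed
  have "apolar_op d u1 u2 f = 0"
    using d l u3 f deg_f deg_B by (rule apolar_op_eq_0) (use l in \<open>auto simp: coeff_f gap_a\<close>)
  then have rec: "(of_nat d - 1 - of_nat j) * u2 * a (Suc j) = u1 * of_nat (j + 2) * a (j + 2)"
    if "j + 2 \<le> d" for j
    using coeff_apolar_op[of d u1 u2 f j] that
    by (simp add: coeff_f del: of_nat_Suc of_nat_add)
  show u1: "u1 = 0"
  proof (rule ccontr)
    assume "u1 \<noteq> 0"
    have "Suc i \<le> d \<longrightarrow> a (Suc i) = 0" if "i \<ge> 1" for i
      using that
    proof (induction i rule: dec_induct)
      case base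
      have "a 2 = 0" using gap_a[of 2] l(1) d by linarith
      then show ?case by (simp add: numeral_2_eq_2)
    next
      case (step n)
      show ?case
      proof
        assume "Suc (Suc n) \<le> d"
        then have "u1 * of_nat (n + 2) * a (n + 2) = 0"
          using rec[of n] step.IH by simp
        moreover have "(of_nat (n + 2) :: complex) \<noteq> 0"
          unfolding of_nat_eq_0_iff by simp
        ultimately show "a (Suc (Suc n)) = 0"
          using \<open>u1 \<noteq> 0\<close> by simp
      qed
    qed
    from this[of "d - 1"] show False using ad d by (cases d) auto
  qed
  show "a i = 0" if "u2 \<noteq> 0" "0 < i" "i < d" for i
  proof -
    have "of_nat d - 1 - of_nat (i - 1) = (of_nat (d - i) :: complex)"
      using that by (simp add: of_nat_diff)
    then show ?thesis
      using rec[of "i - 1"] that u1 by (simp del: of_nat_diff)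
  qed
qed

lemma pderiv_sum: "pderiv (sum f A) = (\<Sum>i\<in>A. pderiv (f i))"
  by (induction A rule: infinite_finite_induct) (simp_all add: pderiv_add)

text \<open>The coefficient of \<open>x^(d-1) y\<close>, read off as the derivative at
  \<open>y = 0\<close> after setting \<open>x = 1\<close>, is \<open>a 1 = 0\<close> on the left and
  \<open>d b0 u1^(d-1) u2\<close> on the right, since \<open>b 1 = 0\<close>.\<close>

lemma gap_form_substitution_triangular:
  fixes a b :: "nat \<Rightarrow> complex"
  assumes d: "d \<ge> 2" and a1: "a 1 = 0" and b1: "b 1 = 0" and b0: "b 0 \<noteq> 0" and u1: "u1 \<noteq> 0"
    and eq: "\<And>x y. (\<Sum>i\<le>d. a i * x ^ (d - i) * y ^ i)
               = (\<Sum>i\<le>d. b i * (u1 * x + u2 * y) ^ (d - i) * (u4 * y) ^ i)"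
  shows "u2 = 0"
proof -
  have "(\<Sum>i\<le>d. monom (a i) i) = (\<Sum>i\<le>d. smult (b i) ([:u1, u2:] ^ (d - i) * [:0, u4:] ^ i))"
    using eq[of 1] by (intro poly_eq_by_values) (simp add: poly_sum poly_monom algebra_simps)
  then have "poly (pderiv (\<Sum>i\<le>d. monom (a i) i)) 0 =
      poly (pderiv (\<Sum>i\<le>d. smult (b i) ([:u1, u2:] ^ (d - i) * [:0, u4:] ^ i))) 0"
    by simp
  moreover have "poly (pderiv (\<Sum>i\<le>d. monom (a i) i)) 0 = a 1"
    using d by (simp add: poly_0_coeff_0 coeff_pderiv coeff_sum)
  moreover have "poly (pderiv (\<Sum>i\<le>d. smult (b i) ([:u1, u2:] ^ (d - i) * [:0, u4:] ^ i))) 0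
      = (\<Sum>i\<in>{0}. b i * (of_nat d * u1 ^ (d - 1) * u2))"
    unfolding pderiv_sum poly_sum
  proof (intro sum.mono_neutral_cong_right ballI)
    fix i assume "i \<in> {..d} - {0}"
    then consider "i = 1" | "i > 1" by force
    then show "poly (pderiv (smult (b i) ([:u1, u2:] ^ (d - i) * [:0, u4:] ^ i))) 0 = 0"
    proof cases
      case 2
      then show ?thesis by (simp add: pderiv_smult pderiv_mult pderiv_power power_0_left)
    qed (use b1 in simp)
  qed (auto simp: pderiv_smult pderiv_power pderiv_pCons)
  ultimately show ?thesis using a1 b0 u1 d by simp
qed

section \<open>Evaluation, coefficients and substitution for binary forms\<close>

text \<open>Turns an identity of forms into one of complex numbers, the shape the substitution
  lemmas take. The outer variable is Y, so \<open>[:y:]\<close> is inserted first.\<close>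

definition poly2_eval :: "complex poly poly \<Rightarrow> complex \<Rightarrow> complex \<Rightarrow> complex" where
  "poly2_eval F x y = poly (poly F [:y:]) x"

lemma poly2_eval_simps [simp]:
  "poly2_eval (F + G) x y = poly2_eval F x y + poly2_eval G x y"
  "poly2_eval (F * G) x y = poly2_eval F x y * poly2_eval G x y"
  "poly2_eval (F ^ n) x y = poly2_eval F x y ^ n"
  "poly2_eval (Const c) x y = c"
  "poly2_eval VarX x y = x"
  "poly2_eval VarY x y = y"
  by (simp_all add: poly2_eval_def Const_def VarX_def VarY_def)

lemma poly2_eval_sum: "poly2_eval (sum F A) x y = (\<Sum>i\<in>A. poly2_eval (F i) x y)"
  by (simp add: poly2_eval_def poly_sum)

lemma Const_0 [simp]: "Const 0 = 0"
  by (simp add: Const_def)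

lemma Const_add: "Const (a + b) = Const a + Const b"
  by (simp add: Const_def)

lemma form_monom: "Const c * VarX ^ k * VarY ^ i = monom (monom c k) i"
proof -
  have X: "VarX ^ k = [:monom 1 k:]"
    by (induction k) (simp_all add: VarX_def monom_altdef one_pCons)
  have Y: "VarY ^ i = monom 1 i"
    by (simp add: VarY_def monom_altdef)
  show ?thesis unfolding X Y by (simp add: Const_def smult_monom)
qed

lemma form_coeff_form:
  assumes "i \<le> d"
  shows "form_coeff d (\<Sum>i\<le>d. Const (a i) * VarX ^ (d - i) * VarY ^ i) i = a i"
  using assms unfolding form_coeff_def form_monom
  by (simp add: coeff_sum if_distrib[of "\<lambda>p. coeff p _"] cong: if_cong)

lemma subst_poly2_add: "subst_poly2 (F + G) P Q = subst_poly2 F P Q + subst_poly2 G P Q"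
proof -
  have "map_poly Const (a + b) = map_poly Const a + map_poly Const b" for a b
    using Const_add by (intro poly_eqI) (simp only: coeff_map_poly Const_0 coeff_add)
  then have "map_poly (\<lambda>c. poly (map_poly Const c) P) (F + G)
      = map_poly (\<lambda>c. poly (map_poly Const c) P) F + map_poly (\<lambda>c. poly (map_poly Const c) P) G"
    by (intro poly_eqI) (simp add: coeff_map_poly)
  then show ?thesis by (simp add: subst_poly2_def)
qed

lemma subst_poly2_sum: "subst_poly2 (sum F A) P Q = (\<Sum>i\<in>A. subst_poly2 (F i) P Q)"
proof (induction A rule: infinite_finite_induct)
qed (simp_all add: subst_poly2_add, simp_all add: subst_poly2_def)

lemma subst_poly2_form:
  "subst_poly2 (\<Sum>i\<le>d. Const (b i) * VarX ^ (d - i) * VarY ^ i) P Q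
     = (\<Sum>i\<le>d. Const (b i) * P ^ (d - i) * Q ^ i)"
  unfolding form_monom subst_poly2_sum
  by (simp add: subst_poly2_def map_poly_monom poly_monom)

text \<open>No \<open>l > d\<close> lies in the set under \<open>Max\<close>, since the coefficient
  of Y^d is nonzero; the set is finite and its maximum belongs to it.\<close>

lemma Lambda_plus_gap:
  assumes "d > 0" "form_coeff d F d \<noteq> 0" "0 < i" "i < Lambda_plus d F"
  shows "form_coeff d F i = 0"
proof -
  let ?S = "{l. \<forall>i. 0 < i \<and> i < l \<longrightarrow> form_coeff d F i = 0}"
  have "?S \<subseteq> {..d}"
    using assms(1,2) by (auto simp: not_less[symmetric])
  then have "finite ?S" by (rule finite_subset) simp
  moreover have "0 \<in> ?S" by simp
  ultimately have "Max ?S \<in> ?S" by (intro Max_in) auto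
  then show ?thesis using assms(3,4) by (simp add: Lambda_plus_def)
qed

lemma binomial_form_if_gap:
  assumes "d > 0" "\<And>i. 0 < i \<Longrightarrow> i < d \<Longrightarrow> a i = 0"
  shows "binomial_form d (\<Sum>i\<le>d. Const (a i) * VarX ^ (d - i) * VarY ^ i)"
proof -
  have "(\<Sum>i\<le>d. Const (a i) * VarX ^ (d - i) * VarY ^ i)
      = (\<Sum>i\<in>{0, d}. Const (a i) * VarX ^ (d - i) * VarY ^ i)"
    using assms by (intro sum.mono_neutral_right) auto
  also have "\<dots> = Const (a 0) * VarX ^ d + Const (a d) * VarY ^ d"
    using assms by simp
  finally show ?thesis unfolding binomial_form_def by blast
qed

theorem theorem3p2:
  fixes d :: nat and K :: "complex set" and E :: "complex poly poly set"
  assumes "d \<ge> 3"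
    and "K \<in> {\<int>, \<rat>, \<real>, UNIV}"
    and "E \<subseteq> binary_forms K d"
    and "reduced_forms K d E"
    and "\<And>F. F \<in> E \<Longrightarrow> real (Lambda_plus d F) \<ge> (real d + 3) / 2"
  shows "homography_free K E"
  unfolding homography_free_def
proof (intro ballI impI notI)
  fix F G
  assume FG: "F \<in> E" "G \<in> E" "F \<noteq> G" and "\<exists>\<gamma>\<in>GL2 K. F = form_comp G \<gamma>"
  then obtain \<gamma> \<delta> where K: "\<gamma> \<in> mat2_over K" "\<delta> \<in> mat2_over K"
    and inv: "\<gamma> ** \<delta> = mat 1" "\<delta> ** \<gamma> = mat 1" and F\<gamma>: "F = form_comp G \<gamma>"
    unfolding GL2_def by blast
  define u1 u2 u3 u4 where u: "u1 = \<gamma> $ 1 $ 1" "u2 = \<gamma> $ 1 $ 2" "u3 = \<gamma> $ 2 $ 1" "u4 = \<gamma> $ 2 $ 2"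
  define v1 v2 v3 v4 where v: "v1 = \<delta> $ 1 $ 1" "v2 = \<delta> $ 1 $ 2" "v3 = \<delta> $ 2 $ 1" "v4 = \<delta> $ 2 $ 2"
  have uv: "u1 * v1 + u2 * v3 = 1" "u1 * v2 + u2 * v4 = 0" "u3 * v1 + u4 * v3 = 0" "u3 * v2 + u4 * v4 = 1"
    using inv(1) by (simp_all add: vec_eq_iff matrix_matrix_mult_def mat_def sum_2 forall_2 u v)
  have vu: "v1 * u1 + v2 * u3 = 1" "v1 * u2 + v2 * u4 = 0" "v3 * u1 + v4 * u3 = 0" "v3 * u2 + v4 * u4 = 1"
    using inv(2) by (simp_all add: vec_eq_iff matrix_matrix_mult_def mat_def sum_2 forall_2 u v)
  have in_K: "u1 \<in> K" "u4 \<in> K" "v1 \<in> K" "v4 \<in> K"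
    using K by (auto simp: mat2_over_def u v)
  obtain a where a: "F = (\<Sum>i\<le>d. Const (a i) * VarX ^ (d - i) * VarY ^ i)"
    using FG assms(3) by (auto simp: binary_forms_def)
  obtain b where b: "G = (\<Sum>i\<le>d. Const (b i) * VarX ^ (d - i) * VarY ^ i)"
    using FG assms(3) by (auto simp: binary_forms_def)
  have ca: "form_coeff d F i = a i" if "i \<le> d" for i
    using that by (simp add: a form_coeff_form)
  have cb: "form_coeff d G i = b i" if "i \<le> d" for i
    using that by (simp add: b form_coeff_form)
  have nz: "a d \<noteq> 0" "b 0 \<noteq> 0" "b d \<noteq> 0"
    using assms(4) FG ca[of d] cb[of 0] cb[of d] by (auto simp: reduced_forms_def)
  \<comment> \<open>This is the ceiling of \<open>(d + 3) / 2\<close>.\<close>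
  define l where "l = (d + 4) div 2"
  have l: "2 * l \<ge> d + 3" "l \<le> d" "l \<ge> 3" using assms(1) by (auto simp: l_def)
  have Lam: "l \<le> Lambda_plus d H" if "H \<in> E" for H
  proof -
    have "d + 3 \<le> 2 * Lambda_plus d H"
      using assms(5)[OF that] by (simp add: field_simps)
    then show ?thesis unfolding l_def by linarith
  qed
  have gap_a: "a i = 0" if "0 < i" "i < l" for i
    using Lambda_plus_gap[of d F i] Lam[OF FG(1)] that l nz ca[of i] ca[of d] assms(1) by simp
  have gap_b: "b i = 0" if "0 < i" "i < l" for i
    using Lambda_plus_gap[of d G i] Lam[OF FG(2)] that l nz cb[of i] cb[of d] assms(1) by simp
  have F_subst: "F = subst_poly2 G (Const u1 * VarX + Const u2 * VarY) (Const u3 * VarX + Const u4 * VarY)"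
    using F\<gamma> by (simp add: form_comp_def u)
  have eval_F: "poly2_eval F x y = (\<Sum>i\<le>d. a i * x ^ (d - i) * y ^ i)" for x y
    by (simp add: a poly2_eval_sum)
  have eval_G: "poly2_eval G x y = (\<Sum>i\<le>d. b i * x ^ (d - i) * y ^ i)" for x y
    by (simp add: b poly2_eval_sum)
  have eq: "(\<Sum>i\<le>d. a i * x ^ (d - i) * y ^ i)
      = (\<Sum>i\<le>d. b i * (u1 * x + u2 * y) ^ (d - i) * (u3 * x + u4 * y) ^ i)" for x y
    unfolding eval_F[symmetric] F_subst b subst_poly2_form by (simp add: poly2_eval_sum)
  \<comment> \<open>Evaluate \<open>eq\<close> at the linear forms of \<open>\<delta>\<close>; the
    product \<open>\<gamma> ** \<delta>\<close> is the identity, so G reappears.\<close>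
  have eq': "(\<Sum>i\<le>d. b i * x ^ (d - i) * y ^ i)
      = (\<Sum>i\<le>d. a i * (v1 * x + v2 * y) ^ (d - i) * (v3 * x + v4 * y) ^ i)" for x y
  proof -
    have "u1 * (v1 * x + v2 * y) + u2 * (v3 * x + v4 * y) = x"
      "u3 * (v1 * x + v2 * y) + u4 * (v3 * x + v4 * y) = y"
      using uv by algebra+
    then show ?thesis by (simp add: eq)
  qed
  show False
  proof (cases "u3 = 0")
    case True
    have "u1 \<noteq> 0" using vu True by auto
    then have "u2 = 0"
      using gap_form_substitution_triangular[of d a b u1 u2 u4] assms(1) gap_a[of 1] gap_b[of 1] l nz eq
      by (simp add: True)
    then have "subst_poly2 G (Const u1 * VarX) (Const u4 * VarY) = F"
      using F_subst True by simp
    \<comment> \<open>With \<open>u2 = u3 = 0\<close>, \<open>uv\<close> reads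
      \<open>u1 * v1 = 1\<close> and \<open>u4 * v4 = 1\<close>; the inverses are entries of
      \<open>\<delta>\<close>, so these are units of \<open>K\<close> itself.\<close>
    moreover have "u1 \<in> unit_group K" "u4 \<in> unit_group K"
      using in_K uv \<open>u2 = 0\<close> True by (auto simp: unit_group_def)
    ultimately show False
      using assms(4) FG unfolding reduced_forms_def dilation_free_def by metis
  next
    case False
    have u1: "u1 = 0"
      using assms(1) l(1,2) gap_a gap_b nz(1) False eq by (rule gap_form_substitution(1))
    then have u2: "u2 \<noteq> 0" using uv by auto
    have "a i = 0" if "0 < i" "i < d" for i
      using assms(1) l(1,2) gap_a gap_b nz(1) False eq u2 that by (rule gap_form_substitution(2))
    then have bF: "binomial_form d F"
      unfolding a using assms(1) by (intro binomial_form_if_gap) auto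
    \<comment> \<open>The same argument runs for \<open>\<delta>\<close> with F and G
      exchanged.\<close>
    have v3: "v3 \<noteq> 0" using u1 uv by auto
    have v1: "v1 = 0"
      using assms(1) l(1,2) gap_b gap_a nz(3) v3 eq' by (rule gap_form_substitution(1))
    have v2: "v2 \<noteq> 0" using v1 vu by auto
    have "b i = 0" if "0 < i" "i < d" for i
      using assms(1) l(1,2) gap_b gap_a nz(3) v3 eq' v2 that by (rule gap_form_substitution(2))
    then have bG: "binomial_form d G"
      unfolding b using assms(1) by (intro binomial_form_if_gap) auto
    have "u4 = 0" using vu(2) v1 v2 by simp
    then have swap: "subst_poly2 G (Const u2 * VarY) (Const u3 * VarX) = F"
      using F_subst u1 by simp
    \<comment> \<open>Swaps of binomials are excluded for all nonzero complex scalars; the condition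
      is applied to the pair \<open>(G, F)\<close>.\<close>
    have "w \<in> unit_group UNIV" if "w \<noteq> 0" for w :: complex
      unfolding unit_group_def using right_inverse[OF that] by blast
    then have "u2 \<in> unit_group UNIV" "u3 \<in> unit_group UNIV"
      using u2 False by simp_all
    moreover have "\<not> (\<exists>F\<in>E. \<exists>G\<in>E. F \<noteq> G \<and> binomial_form d F \<and> binomial_form d G \<and>
         (\<exists>u\<in>unit_group UNIV. \<exists>v\<in>unit_group UNIV.
            subst_poly2 F (Const v * VarY) (Const u * VarX) = G))"
      using assms(4) unfolding reduced_forms_def by (elim conjE)
    ultimately show False
      using swap FG(1,2) FG(3)[symmetric] bF bG by blast
  qed
qed

end
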